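(* Let $X$ be a filtered partially ordered set in which every chain that is bounded below has a greatest lower bound. Let $\Lambda$ be a totally ordered set. Then a function $u:X\to\Lambda$ is a regular quasi-Leontief function if and only if it has Property $(\Phi)$, Property (CIP), and all its (possibly empty) upper level sets $\{x\in X:u(x)\geqslant\lambda\}$, $\lambda\in\Lambda$, are bounded below in $X$.
   Context: A partially ordered set $L$ is filtered if for all $l_1,l_2\in L$ there is $l_3\in L$ with $l_1\geqslant l_3$ and $l_2\geqslant l_3$. A chain is a nonempty totally ordered subset. $u:X\to\Lambda$ is quasi-Leontief if for every $x\in X$ there is $x^\circ\in X$ with $\{x'\in X:u(x')\geqslant u(x)\}=\{x'\in X:x'\geqslant x^\circ\}$. A quasi-Leontief function $u$ is regular if for every $\lambda\in\Lambda$ the set $\{x\in X:u(x)\geqslant\lambda\}$ is either empty or has a smallest element. Property $(\Phi)$: for all $x,x'\in X$ there exists $x''\in X$ such that $x\geqslant x''$, $x'\geqslant x''$ and $\min\{u(x),u(x')\}=u(x'')$. Property (CIP): if $\mathcal C$ is a chain in $X$ for which $\inf\mathcal C$ exists, then $u(\mathcal C)$ has a greatest lower bound in $\Lambda$ and $u(\inf\mathcal C)=\inf u(\mathcal C)$. *)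

theory Defs
  imports "HOL-Library.Lub_Glb"
begin

definition filtered :: "'a::order set \<Rightarrow> bool"
  where "filtered L \<longleftrightarrow> (\<forall>l1\<in>L. \<forall>l2\<in>L. \<exists>l3\<in>L. l3 \<le> l1 \<and> l3 \<le> l2)"

(* The library predicate Complete_Partial_Order.chain also holds of the empty set. *)
definition nonempty_chain :: "'a::order set \<Rightarrow> bool"
  where "nonempty_chain C \<longleftrightarrow> C \<noteq> {} \<and> Complete_Partial_Order.chain (\<le>) C"

definition upper_level_set :: "('a::order \<Rightarrow> 'b::linorder) \<Rightarrow> 'b \<Rightarrow> 'a set"
  where "upper_level_set u a = {x. a \<le> u x}"

definition quasi_Leontief :: "('a::order \<Rightarrow> 'b::linorder) \<Rightarrow> bool"
  where "quasi_Leontief u \<longleftrightarrow> (\<forall>x. \<exists>x0. {x'. u x \<le> u x'} = {x'. x0 \<le> x'})"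

definition regular_quasi_Leontief :: "('a::order \<Rightarrow> 'b::linorder) \<Rightarrow> bool"
  where "regular_quasi_Leontief u \<longleftrightarrow>
    quasi_Leontief u \<and>
    (\<forall>a. upper_level_set u a = {} \<or>
         (\<exists>m\<in>upper_level_set u a. \<forall>x\<in>upper_level_set u a. m \<le> x))"

definition property_Phi :: "('a::order \<Rightarrow> 'b::linorder) \<Rightarrow> bool"
  where "property_Phi u \<longleftrightarrow>
    (\<forall>x x'. \<exists>x''. x'' \<le> x \<and> x'' \<le> x' \<and> min (u x) (u x') = u x'')"

(* Infima are partial in both orders: "isGlb UNIV S l" says that the greatest
   lower bound of S exists and is l. The conclusion below therefore includes
   the existence of the infimum of the image of C. *)
definition property_CIP :: "('a::order \<Rightarrow> 'b::linorder) \<Rightarrow> bool"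
  where "property_CIP u \<longleftrightarrow>
    (\<forall>C l. nonempty_chain C \<longrightarrow> isGlb UNIV C l \<longrightarrow> isGlb UNIV (u ` C) (u l))"

end

theory Submission
  imports Defs
begin

text \<open>
  A quasi-Leontief function is monotone because each level set \<open>{x'. u x \<le> u x'}\<close> is an up-set;
  the least elements of level sets are the witnesses for \<open>(\<Phi>)\<close> and, under regularity, for the
  inequality \<open>a \<le> u (inf C)\<close> needed for \<open>(CIP)\<close>. Conversely, \<open>(CIP)\<close> applied to two-element
  chains gives monotonicity, and applied to chains inside a level set it shows, with Zorn's lemma, that every nonempty level set has a
  minimal element; \<open>(\<Phi>)\<close> makes level sets filtered, so a minimal element is the smallest one.
\<close>

lemma isGlb_UNIV_iff:
  "isGlb UNIV S l \<longleftrightarrow> (\<forall>s\<in>S. l \<le> s) \<and> (\<forall>b. (\<forall>s\<in>S. b \<le> s) \<longrightarrow> b \<le> l)"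
  unfolding isGlb_def greatestP_def isLb_def setge_def setle_def by auto

text \<open>Zorn's lemma for the reversed order. Only nonempty chains need lower bounds, because
  (CIP) says nothing about the empty chain; for that one any element of \<open>S\<close>
  serves.\<close>

lemma Zorn_minimal:
  fixes S :: "'a::order set"
  assumes "S \<noteq> {}"
    and lower: "\<And>C. nonempty_chain C \<Longrightarrow> C \<subseteq> S \<Longrightarrow> \<exists>l\<in>S. \<forall>c\<in>C. l \<le> c"
  obtains m where "m \<in> S" "\<And>x. x \<in> S \<Longrightarrow> x \<le> m \<Longrightarrow> x = m"
proof -
  have "\<exists>m\<in>S. \<forall>x\<in>S. x \<le> m \<longrightarrow> x = m"
  proof (rule predicate_Zorn)
    show "partial_order_on S (relation_of (\<lambda>x y. y \<le> x) S)"
      by (rule partial_order_on_relation_ofI) auto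
    fix C assume C: "C \<in> Chains (relation_of (\<lambda>x y. y \<le> x) S)"
    show "\<exists>l\<in>S. \<forall>c\<in>C. l \<le> c"
    proof (cases "C = {}")
      case True
      then show ?thesis using \<open>S \<noteq> {}\<close> by auto
    next
      case False
      with C have "nonempty_chain C" "C \<subseteq> S"
        unfolding nonempty_chain_def Chains_def relation_of_def Complete_Partial_Order.chain_def
        by blast+
      then show ?thesis by (rule lower)
    qed
  qed
  then show thesis using that by blast
qed

lemma quasi_Leontief_mono:
  assumes "quasi_Leontief u" "x \<le> y"
  shows "u x \<le> u y"
proof -
  obtain x0 where x0: "{x'. u x \<le> u x'} = {x'. x0 \<le> x'}"
    using assms unfolding quasi_Leontief_def by blast
  then have "x0 \<le> x" by blast
  with assms(2) x0 show ?thesis by (blast intro: order_trans)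
qed

text \<open>If \<open>u x \<le> u y\<close>, both points lie in the level set of \<open>u x\<close>,
  so its least element \<open>x0\<close> is below both; monotonicity forces
  \<open>u x0 = u x\<close>, the minimum. The other case is symmetric.\<close>

lemma quasi_Leontief_imp_property_Phi:
  assumes "quasi_Leontief u"
  shows "property_Phi u"
proof -
  have *: "\<exists>z. z \<le> x \<and> z \<le> y \<and> u x = u z" if "u x \<le> u y" for x y
  proof -
    obtain x0 where x0: "{x'. u x \<le> u x'} = {x'. x0 \<le> x'}"
      using assms unfolding quasi_Leontief_def by blast
    then have "x0 \<le> x" "x0 \<le> y" "u x \<le> u x0" using that by blast+
    with quasi_Leontief_mono[OF assms \<open>x0 \<le> x\<close>] show ?thesis by (metis antisym)
  qed
  show ?thesis unfolding property_Phi_def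
  proof (intro allI)
    fix x y
    show "\<exists>z. z \<le> x \<and> z \<le> y \<and> min (u x) (u y) = u z"
    proof (cases "u x \<le> u y")
      case True
      then show ?thesis using *[of x y] by (simp add: min_def)
    next
      case False
      then have "\<exists>z. z \<le> y \<and> z \<le> x \<and> u y = u z" using *[of y x] by simp
      with False show ?thesis unfolding min_def by auto
    qed
  qed
qed

lemma regular_quasi_Leontief_imp_property_CIP:
  fixes u :: "'a::order \<Rightarrow> 'b::linorder"
  assumes "regular_quasi_Leontief u"
  shows "property_CIP u"
  unfolding property_CIP_def
proof (intro allI impI)
  fix C :: "'a set" and l assume C: "nonempty_chain C" and l: "isGlb UNIV C l"
  have mono: "u x \<le> u y" if "x \<le> y" for x y
    using quasi_Leontief_mono[of u, OF _ that] assms unfolding regular_quasi_Leontief_def by simp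
  have "a \<le> u l" if a: "\<forall>c\<in>C. a \<le> u c" for a
  proof -
    have "upper_level_set u a \<noteq> {}"
      using C a unfolding nonempty_chain_def upper_level_set_def by blast
    then obtain m where "a \<le> u m" "\<And>x. a \<le> u x \<Longrightarrow> m \<le> x"
      using assms unfolding regular_quasi_Leontief_def upper_level_set_def by blast
    \<comment> \<open>Every point of \<open>C\<close> has level at least \<open>a\<close>, so
      \<open>m\<close> is a lower bound of \<open>C\<close> and lies below its infimum.\<close>
    moreover from this have "m \<le> l" using a l unfolding isGlb_UNIV_iff by blast
    ultimately show ?thesis using mono[of m l] by (meson order_trans)
  qed
  then show "isGlb UNIV (u ` C) (u l)"
    using l mono unfolding isGlb_UNIV_iff by simp
qed

lemma regular_quasi_Leontief_bdd_below:
  assumes "regular_quasi_Leontief u"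
  shows "bdd_below (upper_level_set u a)"
proof (cases "upper_level_set u a = {}")
  case False
  then show ?thesis using assms unfolding regular_quasi_Leontief_def bdd_below_def by blast
qed simp

lemma property_CIP_mono:
  assumes "property_CIP u" "x \<le> y"
  shows "u x \<le> u y"
proof -
  have "nonempty_chain {x, y}" "isGlb UNIV {x, y} x"
    using assms(2) unfolding nonempty_chain_def Complete_Partial_Order.chain_def isGlb_UNIV_iff
    by auto
  then have "isGlb UNIV (u ` {x, y}) (u x)"
    using assms(1) unfolding property_CIP_def by blast
  then show ?thesis unfolding isGlb_UNIV_iff by auto
qed

text \<open>Level sets are closed under infima of chains: by (CIP), \<open>u l\<close> is the
  greatest lower bound of the values on the chain, so it dominates \<open>a\<close>. This feeds
  Zorn's lemma.\<close>

lemma upper_level_set_least: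
  fixes u :: "'a::order \<Rightarrow> 'b::linorder"
  assumes inf: "\<And>C :: 'a set. nonempty_chain C \<Longrightarrow> bdd_below C \<Longrightarrow> \<exists>l. isGlb UNIV C l"
    and Phi: "property_Phi u" and CIP: "property_CIP u"
    and bdd: "bdd_below (upper_level_set u a)" and ne: "upper_level_set u a \<noteq> {}"
  shows "\<exists>m. a \<le> u m \<and> (\<forall>x. a \<le> u x \<longrightarrow> m \<le> x)"
proof -
  have "\<exists>l\<in>upper_level_set u a. \<forall>c\<in>C. l \<le> c"
    if C: "nonempty_chain C" "C \<subseteq> upper_level_set u a" for C
  proof -
    obtain l where l: "isGlb UNIV C l"
      using inf[OF C(1)] bdd_below_mono[OF bdd C(2)] by blast
    then have "isGlb UNIV (u ` C) (u l)"
      using CIP C(1) unfolding property_CIP_def by blast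
    then have "a \<le> u l"
      using C(2) unfolding isGlb_UNIV_iff upper_level_set_def by blast
    then show ?thesis using l unfolding isGlb_UNIV_iff upper_level_set_def by blast
  qed
  then obtain m where m: "m \<in> upper_level_set u a"
      and min: "\<And>x. x \<in> upper_level_set u a \<Longrightarrow> x \<le> m \<Longrightarrow> x = m"
    using Zorn_minimal[OF ne] by metis
  have "m \<le> x" if "a \<le> u x" for x
  proof -
    \<comment> \<open>Both values in the minimum are at least \<open>a\<close>, so \<open>z\<close>
      stays in the level set; minimality gives \<open>z = m\<close>, whence
      \<open>m \<le> x\<close>.\<close>
    obtain z where z: "z \<le> m" "z \<le> x" "min (u m) (u x) = u z"
      using Phi unfolding property_Phi_def by blast
    have "a \<le> u z"
      using m that unfolding z(3)[symmetric] upper_level_set_def by simp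
    then show ?thesis using min z unfolding upper_level_set_def by blast
  qed
  with m show ?thesis unfolding upper_level_set_def by blast
qed

theorem proposition2p2p1:
  fixes u :: "'a::order \<Rightarrow> 'b::linorder"
  assumes "filtered (UNIV :: 'a set)"
    and "\<And>C :: 'a set. nonempty_chain C \<Longrightarrow> bdd_below C \<Longrightarrow> \<exists>l. isGlb UNIV C l"
  shows "regular_quasi_Leontief u \<longleftrightarrow>
    property_Phi u \<and> property_CIP u \<and> (\<forall>a. bdd_below (upper_level_set u a))"
proof
  assume "regular_quasi_Leontief u"
  then show "property_Phi u \<and> property_CIP u \<and> (\<forall>a. bdd_below (upper_level_set u a))"
    by (simp add: quasi_Leontief_imp_property_Phi regular_quasi_Leontief_imp_property_CIP
      regular_quasi_Leontief_bdd_below regular_quasi_Leontief_def[THEN iffD1])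
next
  assume R: "property_Phi u \<and> property_CIP u \<and> (\<forall>a. bdd_below (upper_level_set u a))"
  have least: "\<exists>m. a \<le> u m \<and> (\<forall>x. a \<le> u x \<longrightarrow> m \<le> x)" if "upper_level_set u a \<noteq> {}" for a
    by (rule upper_level_set_least) (use assms(2) R that in auto)
  \<comment> \<open>This is the level \<open>a = u x\<close>. The least element gives one inclusion,
    monotonicity from (CIP) the other.\<close>
  have "quasi_Leontief u" unfolding quasi_Leontief_def
  proof
    fix x
    have "upper_level_set u (u x) \<noteq> {}" unfolding upper_level_set_def by blast
    then obtain m where m: "u x \<le> u m" "\<forall>y. u x \<le> u y \<longrightarrow> m \<le> y" using least by blast
    have "u x \<le> u y" if "m \<le> y" for y
      using order_trans[OF m(1) property_CIP_mono[of u, OF _ that]] R by simp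
    with m(2) show "\<exists>x0. {x'. u x \<le> u x'} = {x'. x0 \<le> x'}" by blast
  qed
  moreover have "upper_level_set u a = {} \<or>
      (\<exists>m\<in>upper_level_set u a. \<forall>x\<in>upper_level_set u a. m \<le> x)" for a
    using least[of a] unfolding upper_level_set_def by blast
  ultimately show "regular_quasi_Leontief u" unfolding regular_quasi_Leontief_def by blast
qed

end
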